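(* Assume that for every $u\in Y$ the map $t\mapsto\Phi(tu)$, $t>0$, has a unique critical point $t_u>0$, which is a global minimizer (and consequently $\Phi(t_uu)<0$). Assume moreover that: (1) $\Phi$ is coercive in $Y$, i.e. $\Phi(u_n)\to\infty$ if $(u_n)\subset Y$ and $\|u_n\|\to\infty$; (2) $\Phi\geq 0$ on $\partial Y$. Then $c<0$ and $c=\inf_Y\Phi$, so that $c$ is a local minimum of $\Phi$ (i.e. $c$ is the value of $\Phi$ at a local minimizer). If, in addition, $\Phi\geq 0$ on $\mathcal{N}\setminus Y$, then $c$ is the ground state level of $\Phi$.
   Context: $X$ is a reflexive Banach space. $Y\subset X\setminus\{0\}$ is a nonempty open cone, i.e. a nonempty open set such that $tu\in Y$ for every $t>0$ and $u\in Y$. $\partial Y$ denotes the boundary of $Y$ in the weak topology of $X$. $\Phi\in C^1(X,\mathbb{R})$ with $\Phi(0)=0$, and $J:X\to\mathbb{R}$ is given by $J(u)=\Phi'(u)u$. Both $\Phi$ and $J$ are assumed weakly lower semicontinuous on $X$. $\mathcal{N}=\{u\in X\setminus\{0\}: \Phi'(u)u=0\}$ and $c:=\inf_{\mathcal{N}\cap Y}\Phi$. A ground state is a nontrivial critical point of $\Phi$ minimizing $\Phi$ over the set of all nontrivial critical points; a number is the ground state level of $\Phi$ if it is the value of $\Phi$ at a ground state. *)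

theory Defs
  imports "HOL-Analysis.Analysis"
begin

text \<open>Surjectivity of the canonical embedding into the bidual, on the type used as the space.\<close>

definition reflexive_space :: "'a::real_normed_vector itself \<Rightarrow> bool" where
  "reflexive_space _ \<longleftrightarrow>
     (\<forall>F :: ('a \<Rightarrow>\<^sub>L real) \<Rightarrow>\<^sub>L real. \<exists>x. \<forall>f. blinfun_apply F f = blinfun_apply f x)"

definition weak_topology :: "'a::real_normed_vector topology" where
  "weak_topology =
     topology_generated_by {blinfun_apply f -` U | (f :: 'a \<Rightarrow>\<^sub>L real) U. open U}"

text \<open>Weak lower semicontinuity in the sense of the calculus of variations: along weakly
  convergent sequences. This is implied by lower semicontinuity with respect to the weak
  topology.\<close>

definition weakly_lsc :: "('a::real_normed_vector \<Rightarrow> real) \<Rightarrow> bool" where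
  "weakly_lsc \<Phi> \<longleftrightarrow>
     (\<forall>u x. limitin weak_topology u x sequentially \<longrightarrow>
        ereal (\<Phi> x) \<le> liminf (\<lambda>n. ereal (\<Phi> (u n))))"

definition open_cone :: "'a::real_normed_vector set \<Rightarrow> bool" where
  "open_cone Y \<longleftrightarrow> Y \<noteq> {} \<and> open Y \<and> 0 \<notin> Y \<and> (\<forall>t>0. \<forall>u\<in>Y. t *\<^sub>R u \<in> Y)"

text \<open>In this and the following definitions \<open>\<Phi>'\<close> stands for the Frechet derivative of \<open>\<Phi>\<close>;
  for \<open>C1_functional\<close> it is uniquely determined by \<open>\<Phi>\<close>.\<close>

definition C1_functional ::
    "('a::real_normed_vector \<Rightarrow> real) \<Rightarrow> ('a \<Rightarrow> 'a \<Rightarrow>\<^sub>L real) \<Rightarrow> bool" where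
  "C1_functional \<Phi> \<Phi>' \<longleftrightarrow>
     (\<forall>u. (\<Phi> has_derivative blinfun_apply (\<Phi>' u)) (at u)) \<and> continuous_on UNIV \<Phi>'"

definition nehari_set :: "('a::real_normed_vector \<Rightarrow> 'a \<Rightarrow>\<^sub>L real) \<Rightarrow> 'a set" where
  "nehari_set \<Phi>' = {u. u \<noteq> 0 \<and> blinfun_apply (\<Phi>' u) u = 0}"

definition coercive_in :: "('a::real_normed_vector \<Rightarrow> real) \<Rightarrow> 'a set \<Rightarrow> bool" where
  "coercive_in \<Phi> Y \<longleftrightarrow>
     (\<forall>u :: nat \<Rightarrow> 'a. (\<forall>n. u n \<in> Y) \<longrightarrow> filterlim (\<lambda>n. norm (u n)) at_top sequentially \<longrightarrow>
        filterlim (\<lambda>n. \<Phi> (u n)) at_top sequentially)"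

definition fibering_critical_point ::
    "('a::real_normed_vector \<Rightarrow> real) \<Rightarrow> 'a \<Rightarrow> real \<Rightarrow> bool" where
  "fibering_critical_point \<Phi> u t \<longleftrightarrow>
     t > 0 \<and> ((\<lambda>s. \<Phi> (s *\<^sub>R u)) has_real_derivative 0) (at t)"

definition local_minimizer :: "('a::topological_space \<Rightarrow> real) \<Rightarrow> 'a \<Rightarrow> bool" where
  "local_minimizer \<Phi> u \<longleftrightarrow> (\<forall>\<^sub>F v in nhds u. \<Phi> u \<le> \<Phi> v)"

definition ground_state ::
    "('a::real_normed_vector \<Rightarrow> real) \<Rightarrow> ('a \<Rightarrow> 'a \<Rightarrow>\<^sub>L real) \<Rightarrow> 'a \<Rightarrow> bool" where
  "ground_state \<Phi> \<Phi>' u \<longleftrightarrow>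
     u \<noteq> 0 \<and> \<Phi>' u = 0 \<and> (\<forall>v. v \<noteq> 0 \<and> \<Phi>' v = 0 \<longrightarrow> \<Phi> u \<le> \<Phi> v)"

end

theory Submission
  imports Defs "HOL-Complex_Analysis.Great_Picard"
begin

text \<open>The proof is the direct method of the calculus of variations, carried out in the weak
  topology.

  Along a ray through \<open>u \<in> Y\<close> the function \<open>t \<mapsto> \<Phi> (t *\<^sub>R u)\<close> starts from the value \<open>0\<close>
  at \<open>t = 0\<close> and has a single critical point in \<open>t > 0\<close>, its global minimizer. By continuity the
  minimum is at most \<open>0\<close>, and if it were \<open>0\<close>, Rolle's theorem would give a second critical point;
  hence it is negative (\<open>negative_fibering_minimum\<close>) and \<open>\<Phi>\<close> takes negative values in \<open>Y\<close>.

  A minimizing sequence for \<open>\<Phi>\<close> in \<open>Y\<close> can be taken in the set where \<open>\<Phi> \<le> 0\<close>, which is bounded by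
  coercivity. Reflexivity gives a subsequence that converges weakly to some \<open>x\<close>, and by weak lower
  semicontinuity \<open>\<Phi> x \<le> inf \<Phi>\<close> on \<open>Y\<close>, a negative number. The point \<open>x\<close> lies in the weak closure of
  \<open>Y\<close> but not on the weak boundary, where \<open>\<Phi> \<ge> 0\<close>; so \<open>x \<in> Y\<close>, and the infimum over \<open>Y\<close> is attained
  (\<open>attained_minimum_in_cone\<close>). Since \<open>Y\<close> is open in norm, \<open>x\<close> is a local minimizer and
  \<open>\<Phi>' x = 0\<close>. Thus \<open>x\<close> belongs to the Nehari set, and the infimum of \<open>\<Phi>\<close> over the part of the Nehari
  set in \<open>Y\<close> equals the infimum over all of \<open>Y\<close>. Every nontrivial critical point lies in the Nehari
  set, hence either in \<open>Y\<close>, where \<open>\<Phi> \<ge> \<Phi> x\<close>, or outside \<open>Y\<close>, where the last hypothesis gives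
  \<open>\<Phi> \<ge> 0 > \<Phi> x\<close>.

  The functional-analytic input is that bounded sequences in a reflexive space have weakly convergent
  subsequences (\<open>reflexive_weakly_convergent_subsequence\<close>). It rests on one form of the
  Hahn-Banach theorem (\<open>Hahn_Banach_sublinear\<close>), applied three times: to the norm of the space
  (norming functionals), to the distance from a subspace (separation), and, on the dual space, to
  \<open>f \<mapsto> limsup f (u n)\<close>. The last application yields an element of the bidual, which reflexivity turns into
  a point \<open>x\<close> with \<open>f x \<le> limsup f (u n)\<close> for all \<open>f\<close>; along a suitable subsequence there is only one
  such point, and it is the weak limit.\<close>

section \<open>Sublinear functionals and the Hahn-Banach theorem\<close>

text \<open>Homogeneity is stated as an inequality because this is the form that passes to infima;
  applied to \<open>t\<close> and \<open>1 / t\<close> it gives equality.\<close>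

definition sublinear :: "('v::real_vector \<Rightarrow> real) \<Rightarrow> bool" where
  "sublinear q \<longleftrightarrow>
     (\<forall>x y. q (x + y) \<le> q x + q y) \<and> (\<forall>t>0. \<forall>x. q (t *\<^sub>R x) \<le> t * q x)"

lemma sublinear_add: "sublinear q \<Longrightarrow> q (x + y) \<le> q x + q y"
  by (simp add: sublinear_def)

lemma sublinear_zero:
  assumes "sublinear q"
  shows "q 0 = 0"
proof -
  have "q (2 *\<^sub>R 0) \<le> 2 * q 0" "q ((1/2) *\<^sub>R 0) \<le> (1/2) * q 0"
    using assms unfolding sublinear_def by (meson zero_less_numeral half_gt_zero zero_less_one)+
  then show ?thesis by simp
qed

lemma sublinear_scaleR:
  assumes "sublinear q" "t \<ge> 0"
  shows "q (t *\<^sub>R x) = t * q x"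
proof (cases "t = 0")
  case True
  then show ?thesis using sublinear_zero[OF assms(1)] by simp
next
  case False
  then have t: "t > 0" using assms(2) by simp
  have "q (t *\<^sub>R x) \<le> t * q x" using assms(1) t by (simp add: sublinear_def)
  moreover have "q ((1/t) *\<^sub>R (t *\<^sub>R x)) \<le> (1/t) * q (t *\<^sub>R x)"
    using assms(1) t unfolding sublinear_def by (meson zero_less_divide_1_iff)
  then have "t * q x \<le> q (t *\<^sub>R x)"
    using t by (simp add: field_simps)
  ultimately show ?thesis by simp
qed

lemma sublinear_uminus_ge:
  assumes "sublinear q"
  shows "- q (- x) \<le> q x"
  using sublinear_add[OF assms, of x "- x"] sublinear_zero[OF assms] by simp

text \<open>The functional \<open>r y = inf {q (y + t a) - t (q a) | t \<ge> 0}\<close> does it: \<open>t = 0\<close> gives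
  \<open>r \<le> q\<close>, and \<open>t = 1\<close> gives the value at \<open>- a\<close>. The lemma is used twice: it shows that a minimal
  sublinear functional is odd, and it prescribes the value of the Hahn-Banach functional at \<open>a\<close>.\<close>

lemma sublinear_decrease:
  assumes q: "sublinear q"
  shows "\<exists>r. sublinear r \<and> r \<le> q \<and> r (- a) \<le> - q a"
proof -
  define g where "g y t = q (y + t *\<^sub>R a) - t * q a" for y t
  define r where "r y = (INF t\<in>{0..}. g y t)" for y
  have "- q (- y) \<le> g y t" if "t \<ge> 0" for y t
  proof -
    have "q (t *\<^sub>R a) \<le> q (y + t *\<^sub>R a) + q (- y)"
      using sublinear_add[OF q, of "y + t *\<^sub>R a" "- y"] by simp
    then show ?thesis using sublinear_scaleR[OF q that] by (simp add: g_def)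
  qed
  then have bdd: "bdd_below (g y ` {0..})" for y
    by (intro bdd_belowI2) auto
  have le: "r y \<le> g y t" if "t \<ge> 0" for y t
    unfolding r_def using that by (intro cINF_lower bdd) auto
  have ge: "b \<le> r y" if "\<And>t. t \<ge> 0 \<Longrightarrow> b \<le> g y t" for b y
    unfolding r_def using that by (intro cINF_greatest) auto
  have "r (x + y) \<le> r x + r y" for x y
  proof -
    have 1: "r (x + y) \<le> g x s + g y t" if "s \<ge> 0" "t \<ge> 0" for s t
    proof -
      have "r (x + y) \<le> g (x + y) (s + t)" using that by (intro le) simp
      also have "\<dots> \<le> g x s + g y t"
        using sublinear_add[OF q, of "x + s *\<^sub>R a" "y + t *\<^sub>R a"]
        by (simp add: g_def algebra_simps)
      finally show ?thesis .
    qed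
    have "r (x + y) - g y t \<le> r x" if "t \<ge> 0" for t
      using 1[OF _ that] by (intro ge) (simp add: algebra_simps)
    then have "r (x + y) - r x \<le> r y"
      by (intro ge) (simp add: algebra_simps)
    then show ?thesis by simp
  qed
  moreover have "r (s *\<^sub>R x) \<le> s * r x" if s: "s > 0" for s x
  proof -
    have "r (s *\<^sub>R x) / s \<le> g x t" if "t \<ge> 0" for t
    proof -
      have "r (s *\<^sub>R x) \<le> g (s *\<^sub>R x) (s * t)" using that s by (intro le) simp
      also have "\<dots> = s * g x t"
        using sublinear_scaleR[OF q, of s "x + t *\<^sub>R a"] s by (simp add: g_def algebra_simps)
      finally show ?thesis using s by (simp add: field_simps)
    qed
    then have "r (s *\<^sub>R x) / s \<le> r x" by (rule ge)
    then show ?thesis using s by (simp add: field_simps)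
  qed
  ultimately have "sublinear r" by (simp add: sublinear_def)
  moreover have "r \<le> q"
    using le[of 0] by (simp add: le_fun_def g_def)
  moreover have "r (- a) \<le> - q a"
    using le[of 1 "- a"] sublinear_zero[OF q] by (simp add: g_def)
  ultimately show ?thesis by blast
qed

text \<open>The pointwise infimum of the chain. It is finite, since \<open>- p (- x)\<close> is a lower bound for
  all values at \<open>x\<close>.\<close>

lemma sublinear_INF_chain:
  assumes ne: "C \<noteq> {}"
    and sub: "\<And>r. r \<in> C \<Longrightarrow> sublinear r \<and> r \<le> p"
    and chain: "\<And>r s. r \<in> C \<Longrightarrow> s \<in> C \<Longrightarrow> r \<le> s \<or> s \<le> r"
  shows "\<exists>q. sublinear q \<and> (\<forall>r\<in>C. q \<le> r)"
proof -
  define q where "q x = (INF r\<in>C. r x)" for x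
  have "- p (- x) \<le> r x" if "r \<in> C" for r x
  proof -
    have "- r (- x) \<le> r x" "r (- x) \<le> p (- x)"
      using sublinear_uminus_ge[of r x] sub[OF that] by (auto simp: le_fun_def)
    then show ?thesis by linarith
  qed
  then have bdd: "bdd_below ((\<lambda>r. r x) ` C)" for x
    by (intro bdd_belowI2) auto
  have le: "q x \<le> r x" if "r \<in> C" for x r
    unfolding q_def using that by (intro cINF_lower bdd) auto
  have ge: "b \<le> q x" if "\<And>r. r \<in> C \<Longrightarrow> b \<le> r x" for b x
    unfolding q_def using that ne by (intro cINF_greatest) auto
  have "q (x + y) \<le> q x + q y" for x y
  proof -
    have 1: "q (x + y) \<le> r x + s y" if "r \<in> C" "s \<in> C" for r s
    proof -
      \<comment> \<open>Either of two members of the chain may be replaced by the smaller one.\<close>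
      have "r \<le> s \<or> s \<le> r" using that by (rule chain)
      with that obtain t where t: "t \<in> C" "t \<le> r" "t \<le> s" by blast
      have "q (x + y) \<le> t (x + y)" using t by (intro le)
      also have "\<dots> \<le> t x + t y" using sub t by (intro sublinear_add) auto
      also have "\<dots> \<le> r x + s y" using t by (intro add_mono) (auto simp: le_fun_def)
      finally show ?thesis .
    qed
    have "q (x + y) - s y \<le> q x" if "s \<in> C" for s
      using 1[OF _ that] by (intro ge) (simp add: algebra_simps)
    then have "q (x + y) - q x \<le> q y"
      by (intro ge) (simp add: algebra_simps)
    then show ?thesis by simp
  qed
  moreover have "q (s *\<^sub>R x) \<le> s * q x" if s: "s > 0" for s x
  proof -
    have "q (s *\<^sub>R x) / s \<le> r x" if "r \<in> C" for r
      using le[OF that, of "s *\<^sub>R x"] sublinear_scaleR[of r s x] sub[OF that] s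
      by (simp add: field_simps)
    then have "q (s *\<^sub>R x) / s \<le> q x" by (rule ge)
    then show ?thesis using s by (simp add: field_simps)
  qed
  ultimately have "sublinear q" by (simp add: sublinear_def)
  with le show ?thesis by (auto simp: le_fun_def)
qed

text \<open>Zorn's lemma for the reversed pointwise order.\<close>

lemma exists_minimal_sublinear:
  assumes p: "sublinear p"
  shows "\<exists>q. sublinear q \<and> q \<le> p \<and> (\<forall>r. sublinear r \<and> r \<le> q \<longrightarrow> r = q)"
proof -
  define A where "A = {q. sublinear q \<and> q \<le> p}"
  define P where "P = (\<lambda>q r :: 'a \<Rightarrow> real. r \<le> q)"
  have "\<exists>m\<in>A. \<forall>a\<in>A. P m a \<longrightarrow> a = m"
  proof (rule predicate_Zorn)
    show "partial_order_on A (relation_of P A)"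
      by (rule partial_order_on_relation_ofI) (auto simp: P_def)
    fix C assume C: "C \<in> Chains (relation_of P A)"
    then have CA: "\<And>r s. r \<in> C \<Longrightarrow> s \<in> C \<Longrightarrow> r \<in> A \<and> (r \<le> s \<or> s \<le> r)"
      by (auto simp: Chains_def relation_of_def P_def)
    show "\<exists>u\<in>A. \<forall>a\<in>C. P a u"
    proof (cases "C = {}")
      case True
      then show ?thesis using p by (auto simp: A_def)
    next
      case False
      obtain q where q: "sublinear q" "\<forall>r\<in>C. q \<le> r"
        using sublinear_INF_chain[OF False, of p] CA by (auto simp: A_def)
      obtain r where r: "r \<in> C" using False by blast
      then have "q \<le> r" "r \<le> p" using q(2) CA[OF r r] by (auto simp: A_def)
      then have "q \<le> p" by (rule order_trans)
      with q show ?thesis by (auto simp: A_def P_def)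
    qed
  qed
  then show ?thesis unfolding A_def P_def
    by (metis (no_types, lifting) mem_Collect_eq order_trans)
qed

text \<open>The functional that \<open>sublinear_decrease\<close> puts below \<open>q\<close> must be \<open>q\<close> itself, so
  \<open>q (- a) \<le> - q a\<close> for every \<open>a\<close>; an odd sublinear functional is linear.\<close>

lemma minimal_sublinear_is_linear:
  assumes q: "sublinear q" and min: "\<And>r. sublinear r \<Longrightarrow> r \<le> q \<Longrightarrow> r = q"
  shows "linear q"
proof -
  have neg: "q (- a) = - q a" for a
  proof -
    obtain r where "sublinear r" "r \<le> q" "r (- a) \<le> - q a"
      using sublinear_decrease[OF q, of a] by blast
    with min have "q (- a) \<le> - q a" by auto
    with sublinear_uminus_ge[OF q, of a] show ?thesis by linarith
  qed
  have "q (x + y) = q x + q y" for x y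
    using sublinear_add[OF q, of x y] sublinear_add[OF q, of "x + y" "- y"] neg[of y] by simp
  moreover have "q (t *\<^sub>R x) = t * q x" for t x
  proof (cases "t \<ge> 0")
    case True
    then show ?thesis by (rule sublinear_scaleR[OF q])
  next
    case False
    then have "q ((- t) *\<^sub>R x) = (- t) * q x" by (intro sublinear_scaleR[OF q]) simp
    then show ?thesis using neg[of "t *\<^sub>R x"] by simp
  qed
  ultimately show ?thesis by (intro linearI) auto
qed

text \<open>Decreasing \<open>p\<close> at \<open>- a\<close> first forces every linear functional below the result to be at
  least \<open>p a\<close> at \<open>a\<close>.\<close>

theorem Hahn_Banach_sublinear:
  assumes "sublinear p"
  obtains F where "linear F" "\<And>x. F x \<le> p x" "F a = p a"
proof -
  obtain r where r: "sublinear r" "r \<le> p" "r (- a) \<le> - p a"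
    using sublinear_decrease[OF assms] by blast
  obtain F where F: "sublinear F" "F \<le> r" "\<And>s. sublinear s \<Longrightarrow> s \<le> F \<Longrightarrow> s = F"
    using exists_minimal_sublinear[OF r(1)] by blast
  have lin: "linear F" using F by (intro minimal_sublinear_is_linear)
  have le: "F x \<le> p x" for x using F(2) r(2) by (meson le_fun_def order_trans)
  have "F (- a) \<le> - p a" using F(2) r(3) by (meson le_fun_def order_trans)
  then have "F a = p a" using le[of a] linear_neg[OF lin, of a] by simp
  with that lin le show ?thesis by blast
qed

section \<open>Continuous functionals on normed spaces\<close>

lemma Hahn_Banach_blinfun:
  fixes p :: "'a::real_normed_vector \<Rightarrow> real"
  assumes p: "sublinear p" and bound: "\<And>x. p x \<le> K * norm x"
  obtains f :: "'a \<Rightarrow>\<^sub>L real" where "\<And>x. f x \<le> p x" "f a = p a"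
proof -
  obtain F where F: "linear F" "\<And>x. F x \<le> p x" "F a = p a"
    using Hahn_Banach_sublinear[OF p, of a] by blast
  have "norm (F x) \<le> norm x * K" for x
  proof -
    have "F x \<le> K * norm x" "F (- x) \<le> K * norm (- x)"
      using F(2) bound order_trans by blast+
    then show ?thesis using linear_neg[OF F(1), of x] by (simp add: mult.commute)
  qed
  then have "bounded_linear F"
    by (intro bounded_linear_intro[where K=K] linear_add[OF F(1)] linear_scale[OF F(1)])
  then have "blinfun_apply (Blinfun F) = F" by (rule bounded_linear_Blinfun_apply)
  with F that show ?thesis by metis
qed

lemma exists_norming_functional:
  fixes a :: "'a::real_normed_vector"
  obtains f :: "'a \<Rightarrow>\<^sub>L real" where "\<And>x. \<bar>f x\<bar> \<le> norm x" "f a = norm a"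
proof -
  have "sublinear (norm :: 'a \<Rightarrow> real)"
    by (simp add: sublinear_def norm_triangle_ineq)
  then obtain f :: "'a \<Rightarrow>\<^sub>L real" where f: "\<And>x. f x \<le> norm x" "f a = norm a"
    using Hahn_Banach_blinfun[of norm 1 a] by auto
  have "\<bar>f x\<bar> \<le> norm x" for x
    using f(1)[of x] f(1)[of "- x"] by (simp add: blinfun.minus_right)
  with f(2) that show ?thesis by blast
qed

lemma sublinear_infdist_subspace:
  fixes V :: "'a::real_normed_vector set"
  assumes V: "subspace V"
  shows "sublinear (\<lambda>x. infdist x V)"
proof -
  have ne: "V \<noteq> {}" using subspace_0[OF V] by blast
  have approx: "\<exists>v\<in>V. dist x v < d" if "infdist x V < d" for x d
    using that ne by (simp add: infdist_def cINF_less_iff bdd_below_image_dist)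
  have "infdist (x + y) V \<le> infdist x V + infdist y V" for x y
  proof (rule field_le_epsilon)
    fix e :: real assume e: "e > 0"
    obtain v w where vw: "v \<in> V" "w \<in> V"
      "dist x v < infdist x V + e/2" "dist y w < infdist y V + e/2"
      using approx[of x "infdist x V + e/2"] approx[of y "infdist y V + e/2"] e by auto
    have "infdist (x + y) V \<le> dist (x + y) (v + w)"
      using vw V by (intro infdist_le) (simp add: subspace_add)
    also have "\<dots> \<le> dist x v + dist y w" by (rule dist_triangle_add)
    finally show "infdist (x + y) V \<le> infdist x V + infdist y V + e" using vw by simp
  qed
  moreover have "infdist (t *\<^sub>R x) V \<le> t * infdist x V" if t: "t > 0" for t x
  proof -
    have "infdist (t *\<^sub>R x) V / t \<le> dist x v" if "v \<in> V" for v
    proof -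
      have "infdist (t *\<^sub>R x) V \<le> dist (t *\<^sub>R x) (t *\<^sub>R v)"
        using that V by (intro infdist_le) (simp add: subspace_scale)
      also have "\<dots> = t * dist x v"
        using t by (simp add: dist_norm flip: scaleR_diff_right)
      finally show ?thesis using t by (simp add: field_simps)
    qed
    then have "infdist (t *\<^sub>R x) V / t \<le> infdist x V"
      using ne unfolding infdist_notempty[OF ne] by (intro cINF_greatest) auto
    then show ?thesis using t by (simp add: field_simps)
  qed
  ultimately show ?thesis by (simp add: sublinear_def)
qed

text \<open>The Hahn-Banach theorem for the distance from \<open>V\<close>, which vanishes exactly on the closure of
  \<open>V\<close>.\<close>

lemma separating_functional:
  fixes V :: "'a::real_normed_vector set"
  assumes V: "subspace V" and x: "x \<notin> closure V"
  obtains f :: "'a \<Rightarrow>\<^sub>L real" where "\<And>v. v \<in> V \<Longrightarrow> f v = 0" "f x > 0"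
proof -
  have ne: "V \<noteq> {}" using subspace_0[OF V] by blast
  have "infdist y V \<le> 1 * norm y" for y
    using infdist_le[OF subspace_0[OF V], of y] by simp
  then obtain f :: "'a \<Rightarrow>\<^sub>L real" where f: "\<And>y. f y \<le> infdist y V" "f x = infdist x V"
    using Hahn_Banach_blinfun[OF sublinear_infdist_subspace[OF V], of 1 x] by blast
  have "f v = 0" if "v \<in> V" for v
    using f(1)[of v] f(1)[of "- v"] that subspace_neg[OF V that]
    by (simp add: blinfun.minus_right)
  moreover have "f x > 0"
    using f(2) x in_closure_iff_infdist_zero[OF ne] infdist_nonneg[of x V] by (metis order_le_less)
  ultimately show ?thesis using that by blast
qed

section \<open>Weak sequential compactness in reflexive spaces\<close>

text \<open>A functional on the dual space dominated by \<open>p f = limsup f (u n)\<close> is continuous and hence,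
  by reflexivity, the evaluation at some \<open>x\<close>. The point \<open>x\<close> satisfies every eventual upper bound on the
  sequence, and \<open>F g = p g\<close> makes \<open>g x\<close> equal to the upper limit of \<open>g (u n)\<close>. The functional \<open>g\<close> is
  arbitrary but \<open>x\<close> depends on it; if only one point satisfies all the eventual upper bounds, these
  \<open>x\<close> coincide and the sequence converges weakly.\<close>

lemma reflexive_point_attaining_limsup:
  fixes u :: "nat \<Rightarrow> 'a::real_normed_vector" and g :: "'a \<Rightarrow>\<^sub>L real"
  assumes refl: "reflexive_space TYPE('a)" and bound: "\<And>n. norm (u n) \<le> M"
  shows "\<exists>x. (\<forall>(f :: 'a \<Rightarrow>\<^sub>L real) b. (\<forall>\<^sub>F n in sequentially. f (u n) \<le> b) \<longrightarrow> f x \<le> b) \<and>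
      (\<forall>b. g x < b \<longrightarrow> (\<forall>\<^sub>F n in sequentially. g (u n) < b))"
proof -
  \<comment> \<open>\<open>p f\<close> is the upper limit of \<open>f (u n)\<close>, written as the infimum of the eventual upper bounds so
    that it is a real number and sublinearity follows from operations on bounds.\<close>
  define B where "B f = {b. \<forall>\<^sub>F n in sequentially. blinfun_apply f (u n) \<le> b}"
    for f :: "'a \<Rightarrow>\<^sub>L real"
  define p where "p f = Inf (B f)" for f
  have abs: "\<bar>blinfun_apply f (u n)\<bar> \<le> M * norm f" for f :: "'a \<Rightarrow>\<^sub>L real" and n
  proof -
    have "\<bar>blinfun_apply f (u n)\<bar> \<le> norm f * norm (u n)"
      using norm_blinfun[of f "u n"] by simp
    also have "\<dots> \<le> norm f * M" by (intro mult_left_mono bound) simp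
    finally show ?thesis by (simp add: mult.commute)
  qed
  have top: "M * norm f \<in> B f" for f
    using abs by (auto simp: B_def abs_le_iff intro!: always_eventually)
  have low: "- (M * norm f) \<le> b" if b: "b \<in> B f" for b f
  proof -
    obtain n where "f (u n) \<le> b"
      using b eventually_happens'[OF sequentially_bot] unfolding B_def by blast
    then show ?thesis using abs[of f n] by linarith
  qed
  have bdd: "bdd_below (B f)" for f using low by (intro bdd_belowI) auto
  have le: "p f \<le> b" if "b \<in> B f" for f b
    unfolding p_def using that bdd by (rule cInf_lower)
  have ge: "b \<le> p f" if "\<And>b'. b' \<in> B f \<Longrightarrow> b \<le> b'" for f b
    unfolding p_def using that top by (intro cInf_greatest) auto
  have "p (f + h) \<le> p f + p h" for f h
  proof -
    have 1: "p (f + h) \<le> b + b'" if "b \<in> B f" "b' \<in> B h" for b b'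
    proof (rule le)
      show "b + b' \<in> B (f + h)"
        using that unfolding B_def mem_Collect_eq
        by eventually_elim (simp add: blinfun.add_left)
    qed
    have "p (f + h) - b' \<le> p f" if "b' \<in> B h" for b'
      using 1[OF _ that] by (intro ge) (simp add: algebra_simps)
    then have "p (f + h) - p f \<le> p h"
      by (intro ge) (simp add: algebra_simps)
    then show ?thesis by simp
  qed
  moreover have "p (t *\<^sub>R f) \<le> t * p f" if t: "t > 0" for t f
  proof -
    have "p (t *\<^sub>R f) / t \<le> b" if "b \<in> B f" for b
    proof -
      have "t * b \<in> B (t *\<^sub>R f)"
        using that t unfolding B_def mem_Collect_eq
        by (auto elim!: eventually_mono simp: blinfun.scaleR_left)
      then show ?thesis using le t by (simp add: field_simps)
    qed
    then have "p (t *\<^sub>R f) / t \<le> p f" by (rule ge)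
    then show ?thesis using t by (simp add: field_simps)
  qed
  ultimately have "sublinear p" by (simp add: sublinear_def)
  moreover have "p f \<le> M * norm f" for f using top by (rule le)
  ultimately obtain F :: "('a \<Rightarrow>\<^sub>L real) \<Rightarrow>\<^sub>L real" where F: "\<And>f. F f \<le> p f" "F g = p g"
    using Hahn_Banach_blinfun[of p M g] by blast
  obtain x where x: "\<And>f. blinfun_apply F f = blinfun_apply f x"
    using refl unfolding reflexive_space_def by blast
  show ?thesis
  proof (intro exI[of _ x] conjI allI impI)
    show "f x \<le> b" if "\<forall>\<^sub>F n in sequentially. f (u n) \<le> b" for f :: "'a \<Rightarrow>\<^sub>L real" and b
      using F(1)[of f] x[of f] le[of b f] that by (simp add: B_def)
    show "\<forall>\<^sub>F n in sequentially. blinfun_apply g (u n) < b" if "g x < b" for b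
    proof -
      have "Inf (B g) < b" using F(2) x that by (simp add: p_def)
      then obtain b' where "b' \<in> B g" "b' < b"
        using cInf_lessD[of "B g" b] top by blast
      then show ?thesis unfolding B_def mem_Collect_eq by (auto elim!: eventually_mono)
    qed
  qed
qed

text \<open>The set \<open>C\<close> consists of the finite rational combinations of elements of \<open>B\<close>, indexed by
  lists; real multiples of its closure points are limits of rational multiples.\<close>

lemma countable_dense_in_subspace:
  fixes B :: "'a::real_normed_vector set"
  assumes "countable B"
  obtains C where "countable C" "subspace (closure C)" "B \<subseteq> closure C"
proof -
  define \<sigma> :: "(rat \<times> 'a) list \<Rightarrow> 'a"
    where "\<sigma> l = sum_list (map (\<lambda>(r, b). real_of_rat r *\<^sub>R b) l)" for l
  define C where "C = \<sigma> ` lists (UNIV \<times> B)"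
  have "countable C" unfolding C_def
    by (intro countable_image countable_lists countable_SIGMA assms) auto
  moreover have "B \<subseteq> closure C"
  proof -
    have "b = \<sigma> [(1, b)]" for b by (simp add: \<sigma>_def)
    then have "b \<in> C" if "b \<in> B" for b
      using that unfolding C_def by (intro image_eqI[of _ _ "[(1, b)]"]) auto
    then show ?thesis using closure_subset by blast
  qed
  moreover have "subspace (closure C)"
  proof (rule subspaceI)
    have "0 = \<sigma> []" by (simp add: \<sigma>_def)
    then have "0 \<in> C" unfolding C_def by (intro image_eqI[of _ _ "[]"]) auto
    then show "0 \<in> closure C" using closure_subset by blast
  next
    have add: "x + y \<in> C" if xy: "x \<in> C" "y \<in> C" for x y
    proof -
      obtain k l where kl: "k \<in> lists (UNIV \<times> B)" "x = \<sigma> k" "l \<in> lists (UNIV \<times> B)" "y = \<sigma> l"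
        using xy unfolding C_def by blast
      then have "x + y = \<sigma> (k @ l)" by (simp add: \<sigma>_def)
      with kl show ?thesis unfolding C_def by (intro image_eqI[of _ _ "k @ l"]) auto
    qed
    fix x y assume "x \<in> closure C" "y \<in> closure C"
    then obtain X Y where "\<forall>n. X n \<in> C" "X \<longlonglongrightarrow> x" "\<forall>n. Y n \<in> C" "Y \<longlonglongrightarrow> y"
      by (auto simp: closure_sequential)
    then show "x + y \<in> closure C"
      unfolding closure_sequential
      by (intro exI[of _ "\<lambda>n. X n + Y n"]) (auto intro: add tendsto_add)
  next
    have rat: "of_rat r *\<^sub>R x \<in> C" if x: "x \<in> C" for r x
    proof -
      obtain l where l: "l \<in> lists (UNIV \<times> B)" "x = \<sigma> l"
        using x unfolding C_def by blast
      define k where "k = map (\<lambda>(s, b). (r * s, b)) l"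
      have "of_rat r *\<^sub>R \<sigma> l = \<sigma> k" unfolding k_def
        by (induction l) (auto simp: \<sigma>_def scaleR_right_distrib of_rat_mult)
      moreover have "k \<in> lists (UNIV \<times> B)" using l(1) by (auto simp: k_def)
      ultimately show ?thesis using l unfolding C_def by blast
    qed
    fix a :: real and x assume "x \<in> closure C"
    then obtain X where X: "\<forall>n. X n \<in> C" "X \<longlonglongrightarrow> x"
      by (auto simp: closure_sequential)
    have "a \<in> closure \<rat>" by (simp add: Rats_closure_real)
    then obtain A where A: "\<forall>n. A n \<in> \<rat>" "A \<longlonglongrightarrow> a"
      unfolding closure_sequential by blast
    have "A n *\<^sub>R X n \<in> C" for n
      using A(1) X(1) rat by (metis Rats_cases)
    then show "a *\<^sub>R x \<in> closure C"
      unfolding closure_sequential using X(2) A(2)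
      by (intro exI[of _ "\<lambda>n. A n *\<^sub>R X n"]) (auto intro: tendsto_scaleR)
  qed
  ultimately show ?thesis using that by blast
qed

text \<open>The sets \<open>W\<close> such that \<open>x \<in> W\<close> implies \<open>u n \<in> W\<close> eventually are closed under finite
  intersections and arbitrary unions, so it suffices to look at the subbasic sets.\<close>

lemma limitin_weak_topology:
  fixes u :: "nat \<Rightarrow> 'a::real_normed_vector"
  assumes conv: "\<And>f :: 'a \<Rightarrow>\<^sub>L real. (\<lambda>n. f (u n)) \<longlonglongrightarrow> f x"
  shows "limitin weak_topology u x sequentially"
proof -
  define S where "S = {blinfun_apply f -` U | (f :: 'a \<Rightarrow>\<^sub>L real) U. open U}"
  have "\<forall>\<^sub>F n in sequentially. u n \<in> W" if "generate_topology_on S W" "x \<in> W" for W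
    using that
  proof (induction rule: generate_topology_on.induct)
    case (Basis W)
    then obtain f :: "'a \<Rightarrow>\<^sub>L real" and U where "W = blinfun_apply f -` U" "open U"
      unfolding S_def by blast
    then show ?case using topological_tendstoD[OF conv[of f], of U] Basis by simp
  next
    case (UN K)
    then obtain k where "k \<in> K" "x \<in> k" by blast
    with UN have "\<forall>\<^sub>F n in sequentially. u n \<in> k" by blast
    then show ?case by (rule eventually_mono) (use \<open>k \<in> K\<close> in blast)
  qed (simp_all add: eventually_conj)
  moreover have "UNIV \<in> S"
    unfolding S_def by (intro CollectI exI[of _ 0] exI[of _ UNIV]) auto
  then have "topspace weak_topology = (UNIV :: 'a set)"
    unfolding weak_topology_def S_def[symmetric] topology_generated_by_topspace by blast
  moreover have "generate_topology_on S W" if "openin weak_topology W" for W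
    using that unfolding weak_topology_def S_def[symmetric]
    by (simp add: openin_topology_generated_by_iff)
  ultimately show ?thesis by (simp add: limitin_def)
qed

text \<open>Let \<open>C\<close> be countable and dense in a closed subspace containing the sequence. A diagonal
  argument makes a norming functional of each \<open>z \<in> C\<close> converge along a subsequence \<open>v\<close>. Call
  \<open>x\<close> dominated by \<open>v\<close> if \<open>f x \<le> limsup f (v n)\<close> for all \<open>f\<close>; then \<open>f x = lim f (v n)\<close> whenever this limit
  exists. By separation all dominated points lie in the subspace, and the norming functionals take the
  same values at any two of them. These functionals separate the points of the subspace, so there is at
  most one dominated point, and \<open>reflexive_point_attaining_limsup\<close> gives convergence of \<open>f (v n)\<close> for every \<open>f\<close>.\<close>

theorem reflexive_weakly_convergent_subsequence:
  fixes u :: "nat \<Rightarrow> 'a::real_normed_vector"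
  assumes refl: "reflexive_space TYPE('a)" and bound: "\<And>n. norm (u n) \<le> M"
  obtains x k where "strict_mono k" "limitin weak_topology (u \<circ> k) x sequentially"
proof -
  have "countable (range u)" by simp
  then obtain C where C: "countable C" "subspace (closure C)" "range u \<subseteq> closure C"
    by (rule countable_dense_in_subspace)
  have "\<forall>z. \<exists>f :: 'a \<Rightarrow>\<^sub>L real. (\<forall>x. \<bar>f x\<bar> \<le> norm x) \<and> f z = norm z"
    by (meson exists_norming_functional)
  then obtain \<phi> :: "'a \<Rightarrow> 'a \<Rightarrow>\<^sub>L real"
    where \<phi>: "\<And>z x. \<bar>\<phi> z x\<bar> \<le> norm x" "\<And>z. \<phi> z z = norm z"
    by metis
  have "norm (\<phi> z (u n)) \<le> M" for z n
    using \<phi>(1)[of z "u n"] bound[of n] by simp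
  then obtain k where k: "strict_mono k" "\<And>z. z \<in> C \<Longrightarrow> \<exists>l. (\<lambda>n. \<phi> z (u (k n))) \<longlonglongrightarrow> l"
    using function_convergent_subsequence[of C "\<lambda>n z. \<phi> z (u n)" M] C(1) by metis
  define v where "v = u \<circ> k"
  \<comment> \<open>The condition \<open>f x \<le> limsup f (v n)\<close> for all \<open>f\<close>, expressed by eventual upper bounds.\<close>
  define dominated where "dominated x \<longleftrightarrow>
    (\<forall>(f :: 'a \<Rightarrow>\<^sub>L real) b. (\<forall>\<^sub>F n in sequentially. f (v n) \<le> b) \<longrightarrow> f x \<le> b)" for x
  have dominated_lim: "f x = l" if x: "dominated x" and l: "(\<lambda>n. f (v n)) \<longlonglongrightarrow> l"
    for f :: "'a \<Rightarrow>\<^sub>L real" and x l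
  proof (rule antisym)
    show "f x \<le> l"
    proof (rule field_le_epsilon)
      fix e :: real assume "e > 0"
      then have "\<forall>\<^sub>F n in sequentially. f (v n) < l + e"
        using order_tendstoD(2)[OF l] by simp
      then have "\<forall>\<^sub>F n in sequentially. f (v n) \<le> l + e" by (auto elim: eventually_mono)
      with x show "f x \<le> l + e" unfolding dominated_def by blast
    qed
    show "l \<le> f x"
    proof (rule field_le_epsilon)
      fix e :: real assume "e > 0"
      then have "\<forall>\<^sub>F n in sequentially. l - e < f (v n)"
        using order_tendstoD(1)[OF l] by simp
      then have "\<forall>\<^sub>F n in sequentially. (- f) (v n) \<le> e - l"
        by (auto elim: eventually_mono simp: blinfun.minus_left)
      with x have "(- f) x \<le> e - l" unfolding dominated_def by blast
      then show "l \<le> f x + e" by (simp add: blinfun.minus_left)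
    qed
  qed
  have dominated_closure: "x \<in> closure C" if "dominated x" for x
  proof (rule ccontr)
    assume "x \<notin> closure C"
    then obtain f :: "'a \<Rightarrow>\<^sub>L real" where f: "\<And>w. w \<in> closure C \<Longrightarrow> f w = 0" "f x > 0"
      using separating_functional[OF C(2), of x] by auto
    have "f (v n) = 0" for n using C(3) by (intro f(1)) (auto simp: v_def)
    then have "f x = 0" using dominated_lim[OF that, of f 0] by simp
    with f(2) show False by simp
  qed
  have dominated_unique: "x = y" if xy: "dominated x" "dominated y" for x y
  proof -
    have same: "\<phi> z (x - y) = 0" if z: "z \<in> C" for z
    proof -
      obtain l where "(\<lambda>n. \<phi> z (v n)) \<longlonglongrightarrow> l" using k(2)[OF z] by (auto simp: v_def)
      then have "\<phi> z x = l" "\<phi> z y = l" using dominated_lim xy by blast+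
      then show ?thesis by (simp add: blinfun.diff_right)
    qed
    have xyC: "x - y \<in> closure C"
      using C(2) dominated_closure xy by (intro subspace_diff)
    have "norm (x - y) \<le> 0 + e" if "e > 0" for e
    proof -
      obtain z where z: "z \<in> C" "dist z (x - y) < e / 2"
        using xyC \<open>e > 0\<close> unfolding closure_approachable by (meson half_gt_zero)
      \<comment> \<open>If \<open>x - y\<close> is annihilated by \<open>\<phi> z\<close>, then \<open>z\<close> cannot be longer than its distance to
        \<open>x - y\<close>.\<close>
      have "norm z = \<phi> z (z - (x - y))"
        using \<phi>(2)[of z] same[OF z(1)] by (simp add: blinfun.diff_right)
      also have "\<dots> \<le> norm (z - (x - y))" using \<phi>(1) abs_le_D1 by blast
      finally have "norm z \<le> dist z (x - y)" by (simp add: dist_norm)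
      moreover have "norm (x - y) \<le> norm z + dist z (x - y)"
        using norm_triangle_ineq2[of "x - y" z] by (simp add: dist_norm norm_minus_commute)
      ultimately show ?thesis using z(2) by simp
    qed
    then have "norm (x - y) \<le> 0" by (rule field_le_epsilon)
    then show ?thesis by simp
  qed
  have vb: "norm (v n) \<le> M" for n by (simp add: v_def bound)
  have ex: "\<exists>x. dominated x \<and> (\<forall>b. g x < b \<longrightarrow> (\<forall>\<^sub>F n in sequentially. g (v n) < b))"
    for g :: "'a \<Rightarrow>\<^sub>L real"
    unfolding dominated_def using refl vb by (rule reflexive_point_attaining_limsup)
  obtain x where x: "dominated x" using ex by blast
  have upper: "\<forall>\<^sub>F n in sequentially. g (v n) < b" if "g x < b" for g :: "'a \<Rightarrow>\<^sub>L real" and b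
    using ex[of g] dominated_unique[OF x] that by blast
  have "(\<lambda>n. f (v n)) \<longlonglongrightarrow> f x" for f :: "'a \<Rightarrow>\<^sub>L real"
  proof (rule order_tendstoI)
    show "\<forall>\<^sub>F n in sequentially. f (v n) < b" if "f x < b" for b using that by (rule upper)
    show "\<forall>\<^sub>F n in sequentially. b < f (v n)" if "b < f x" for b
      using upper[of "- f" "- b"] that by (simp add: blinfun.minus_left)
  qed
  then have "limitin weak_topology v x sequentially" by (rule limitin_weak_topology)
  with k(1) that show ?thesis by (simp add: v_def)
qed

section \<open>Minimization over the cone\<close>

text \<open>Otherwise \<open>t \<mapsto> \<Phi> (t *\<^sub>R u)\<close> takes the value \<open>0\<close> at both ends of \<open>{0..t}\<close>, and Rolle's theorem
  yields a critical point before \<open>t\<close>.\<close>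

lemma negative_fibering_minimum:
  assumes C1: "C1_functional \<Phi> \<Phi>'" and zero: "\<Phi> 0 = 0"
    and crit: "fibering_critical_point \<Phi> u t"
    and unique: "\<And>s. fibering_critical_point \<Phi> u s \<Longrightarrow> s = t"
    and min: "\<And>s. s > 0 \<Longrightarrow> \<Phi> (t *\<^sub>R u) \<le> \<Phi> (s *\<^sub>R u)"
  shows "\<Phi> (t *\<^sub>R u) < 0"
proof -
  define h where "h s = \<Phi> (s *\<^sub>R u)" for s :: real
  have t: "t > 0" using crit by (simp add: fibering_critical_point_def)
  have dh: "(h has_real_derivative blinfun_apply (\<Phi>' (s *\<^sub>R u)) u) (at s)" for s
  proof -
    have "(\<Phi> has_derivative blinfun_apply (\<Phi>' (s *\<^sub>R u))) (at (s *\<^sub>R u))"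
      using C1 by (simp add: C1_functional_def)
    moreover have "((\<lambda>s. s *\<^sub>R u) has_derivative (\<lambda>r. r *\<^sub>R u)) (at s)"
      by (auto intro!: derivative_eq_intros)
    ultimately have "((\<lambda>s. \<Phi> (s *\<^sub>R u)) has_derivative
        (\<lambda>r. blinfun_apply (\<Phi>' (s *\<^sub>R u)) (r *\<^sub>R u))) (at s)"
      by (rule has_derivative_compose[rotated])
    then show ?thesis
      unfolding has_field_derivative_def h_def
      by (simp add: blinfun.scaleR_right mult_commute_abs)
  qed
  then have cont: "isCont h s" for s using DERIV_isCont by blast
  have le0: "h t \<le> h 0"
  proof (rule tendsto_lowerbound)
    show "(h \<longlongrightarrow> h 0) (at_right 0)"
      using cont[of 0] by (simp add: isCont_def filterlim_at_split)
    show "\<forall>\<^sub>F s in at_right 0. h t \<le> h s"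
      using min by (auto simp: h_def eventually_at_filter intro: always_eventually)
  qed simp
  have "h t \<noteq> h 0"
  proof
    assume eq: "h t = h 0"
    have "\<exists>z. 0 < z \<and> z < t \<and> (h has_real_derivative 0) (at z)"
    proof (rule Rolle[OF t])
      show "h 0 = h t" using eq by simp
      show "continuous_on {0..t} h" using cont by (simp add: continuous_at_imp_continuous_on)
      show "\<And>x. h differentiable (at x)" using dh real_differentiable_def by blast
    qed
    then obtain z where "0 < z" "z < t" "(h has_real_derivative 0) (at z)" by blast
    then have "fibering_critical_point \<Phi> u z"
      by (simp add: fibering_critical_point_def h_def[abs_def])
    with unique \<open>z < t\<close> show False by blast
  qed
  with le0 zero show ?thesis by (simp add: h_def)
qed

lemma coercive_sublevel_bounded:
  assumes "coercive_in \<Phi> Y"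
  shows "bounded {u \<in> Y. \<Phi> u \<le> a}"
proof (rule ccontr)
  assume "\<not> bounded {u \<in> Y. \<Phi> u \<le> a}"
  then have "\<forall>n::nat. \<exists>u\<in>Y. \<Phi> u \<le> a \<and> real n \<le> norm u"
    unfolding bounded_iff by (metis (mono_tags, lifting) linear mem_Collect_eq)
  then obtain u where u: "\<And>n. u n \<in> Y" "\<And>n. \<Phi> (u n) \<le> a" "\<And>n::nat. real n \<le> norm (u n)"
    by metis
  have "filterlim (\<lambda>n. norm (u n)) at_top sequentially"
    using u(3) by (intro filterlim_at_top_mono[OF filterlim_real_sequentially]) auto
  then have "filterlim (\<lambda>n. \<Phi> (u n)) at_top sequentially"
    using assms u(1) unfolding coercive_in_def by blast
  then have "\<forall>\<^sub>F n in sequentially. a < \<Phi> (u n)"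
    by (simp add: filterlim_at_top_dense)
  then obtain n where "a < \<Phi> (u n)" using eventually_happens'[OF sequentially_bot] by blast
  then show False using u(2)[of n] by simp
qed

lemma weak_limit_in_closure:
  assumes lim: "limitin T u x sequentially" and u: "\<And>n::nat. u n \<in> Y"
  shows "x \<in> T closure_of Y"
  unfolding in_closure_of
proof (intro conjI allI impI)
  show "x \<in> topspace T" using lim by (simp add: limitin_def)
  fix W assume "x \<in> W \<and> openin T W"
  then have "\<forall>\<^sub>F n in sequentially. u n \<in> W" using lim by (simp add: limitin_def)
  then show "\<exists>y. y \<in> Y \<and> y \<in> W" using u eventually_happens'[OF sequentially_bot] by blast
qed

text \<open>The boundary condition replaces weak closedness of \<open>Y\<close>: a weak limit of a minimizing
  sequence has a negative value, so it cannot have left \<open>Y\<close> through the weak boundary.\<close>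

lemma attained_minimum_in_cone:
  fixes \<Phi> :: "'a::real_normed_vector \<Rightarrow> real"
  assumes refl: "reflexive_space TYPE('a)" and lsc: "weakly_lsc \<Phi>" and coer: "coercive_in \<Phi> Y"
    and frontier: "\<And>u. u \<in> weak_topology frontier_of Y \<Longrightarrow> \<Phi> u \<ge> 0"
    and neg: "w \<in> Y" "\<Phi> w < 0"
  obtains x where "x \<in> Y" "\<And>y. y \<in> Y \<Longrightarrow> \<Phi> x \<le> \<Phi> y"
proof -
  \<comment> \<open>The infimum is taken in the extended reals, since it is known to be finite only once it is
    attained.\<close>
  define S where "S = {y \<in> Y. \<Phi> y \<le> 0}"
  define m where "m = (INF y\<in>S. ereal (\<Phi> y))"
  have wS: "w \<in> S" using neg by (simp add: S_def)
  obtain v where v: "\<forall>n. v n \<in> (\<lambda>y. ereal (\<Phi> y)) ` S" "v \<longlonglongrightarrow> m"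
    unfolding m_def using Inf_as_limit[of "(\<lambda>y. ereal (\<Phi> y)) ` S"] wS by blast
  then have "\<forall>n. \<exists>y\<in>S. v n = ereal (\<Phi> y)" by blast
  then obtain u where u: "\<And>n. u n \<in> S" "\<And>n. v n = ereal (\<Phi> (u n))" by metis
  obtain M where "\<And>y. y \<in> S \<Longrightarrow> norm y \<le> M"
    using coercive_sublevel_bounded[OF coer, of 0] unfolding S_def bounded_iff by blast
  then have "\<And>n. norm (u n) \<le> M" using u(1) by blast
  then obtain x k where k: "strict_mono k" and x: "limitin weak_topology (u \<circ> k) x sequentially"
    using reflexive_weakly_convergent_subsequence[OF refl] by metis
  have "(v \<circ> k) \<longlonglongrightarrow> m" using v(2) k by (rule LIMSEQ_subseq_LIMSEQ)
  then have "liminf (v \<circ> k) = m" by (intro lim_imp_Liminf) auto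
  moreover have "ereal (\<Phi> x) \<le> liminf (\<lambda>n. ereal (\<Phi> ((u \<circ> k) n)))"
    using lsc x unfolding weakly_lsc_def by blast
  ultimately have le: "ereal (\<Phi> x) \<le> m" by (simp add: u(2) o_def)
  have min: "\<Phi> x \<le> \<Phi> y" if "y \<in> S" for y
    using le INF_lower[OF that, of "\<lambda>y. ereal (\<Phi> y)"] unfolding m_def
    by (meson ereal_less_eq(3) order_trans)
  have "\<Phi> x < 0" using min[OF wS] neg by simp
  then have "x \<notin> weak_topology frontier_of Y" using frontier[of x] by auto
  moreover have "x \<in> weak_topology closure_of Y"
    using u(1) by (intro weak_limit_in_closure[OF x]) (auto simp: S_def)
  ultimately have "x \<in> weak_topology interior_of Y" by (simp add: frontier_of_def)
  then have "x \<in> Y" by (rule subsetD[OF interior_of_subset])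
  moreover have "\<Phi> x \<le> \<Phi> y" if "y \<in> Y" for y
    using min[of y] \<open>\<Phi> x < 0\<close> that by (cases "\<Phi> y \<le> 0") (auto simp: S_def)
  ultimately show ?thesis using that by blast
qed

theorem theorem2p2:
  fixes \<Phi> :: "'a::banach \<Rightarrow> real"
    and \<Phi>' :: "'a \<Rightarrow> 'a \<Rightarrow>\<^sub>L real"
    and Y :: "'a set"
    and c :: ereal
  assumes "reflexive_space TYPE('a)"
    and "open_cone Y"
    and "C1_functional \<Phi> \<Phi>'"
    and "\<Phi> 0 = 0"
    and "weakly_lsc \<Phi>"
    and "weakly_lsc (\<lambda>u. blinfun_apply (\<Phi>' u) u)"
    and c_def: "c = (INF u \<in> nehari_set \<Phi>' \<inter> Y. ereal (\<Phi> u))"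
    and fibering: "\<And>u. u \<in> Y \<Longrightarrow> \<exists>t. fibering_critical_point \<Phi> u t \<and>
           (\<forall>s. fibering_critical_point \<Phi> u s \<longrightarrow> s = t) \<and>
           (\<forall>s>0. \<Phi> (t *\<^sub>R u) \<le> \<Phi> (s *\<^sub>R u))"
    and "coercive_in \<Phi> Y"
    and "\<And>u. u \<in> weak_topology frontier_of Y \<Longrightarrow> \<Phi> u \<ge> 0"
  shows "c < 0 \<and> c = (INF u \<in> Y. ereal (\<Phi> u)) \<and>
         (\<exists>u. local_minimizer \<Phi> u \<and> c = ereal (\<Phi> u)) \<and>
         ((\<forall>u \<in> nehari_set \<Phi>' - Y. \<Phi> u \<ge> 0) \<longrightarrow>
            (\<exists>u. ground_state \<Phi> \<Phi>' u \<and> c = ereal (\<Phi> u)))"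
proof -
  have Y: "Y \<noteq> {}" "open Y" "0 \<notin> Y" "\<And>t u. t > 0 \<Longrightarrow> u \<in> Y \<Longrightarrow> t *\<^sub>R u \<in> Y"
    using assms(2) by (auto simp: open_cone_def)
  obtain u where u: "u \<in> Y" using Y(1) by blast
  obtain t where t: "fibering_critical_point \<Phi> u t"
    "\<And>s. fibering_critical_point \<Phi> u s \<Longrightarrow> s = t"
    "\<And>s. s > 0 \<Longrightarrow> \<Phi> (t *\<^sub>R u) \<le> \<Phi> (s *\<^sub>R u)"
    using fibering[OF u] by blast
  have "\<Phi> (t *\<^sub>R u) < 0" using negative_fibering_minimum[OF assms(3,4) t] .
  moreover have "t *\<^sub>R u \<in> Y"
    using Y(4) u t(1) by (simp add: fibering_critical_point_def)
  ultimately obtain x where x: "x \<in> Y" "\<And>y. y \<in> Y \<Longrightarrow> \<Phi> x \<le> \<Phi> y" and neg: "\<Phi> x < 0"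
    using attained_minimum_in_cone[OF assms(1,5,9,10)] by (metis order_le_less_trans)
  have nhds: "\<forall>\<^sub>F v in nhds x. \<Phi> x \<le> \<Phi> v"
    using eventually_nhds_in_open[OF Y(2) x(1)] by (rule eventually_mono) (rule x(2))
  have "blinfun_apply (\<Phi>' x) = (\<lambda>h. 0)"
  proof (rule has_derivative_local_min)
    show "(\<Phi> has_derivative blinfun_apply (\<Phi>' x)) (at x)"
      using assms(3) by (simp add: C1_functional_def)
    show "\<forall>\<^sub>F v in at x. \<Phi> x \<le> \<Phi> v"
      using nhds by (simp add: eventually_at_filter eventually_mono)
  qed
  then have crit: "\<Phi>' x = 0" by (intro blinfun_eqI) simp
  have x0: "x \<noteq> 0" using x(1) Y(3) by blast
  have inf: "c = ereal (\<Phi> x)"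
    unfolding c_def using x crit x0
    by (intro antisym INF_lower INF_greatest) (auto simp: nehari_set_def)
  moreover have "(INF y\<in>Y. ereal (\<Phi> y)) = ereal (\<Phi> x)"
    using x by (intro antisym INF_lower INF_greatest) auto
  moreover have "local_minimizer \<Phi> x" using nhds by (simp add: local_minimizer_def)
  moreover have "ground_state \<Phi> \<Phi>' x" if out: "\<forall>u \<in> nehari_set \<Phi>' - Y. \<Phi> u \<ge> 0"
    unfolding ground_state_def
  proof (intro conjI allI impI x0 crit)
    fix v assume "v \<noteq> 0 \<and> \<Phi>' v = 0"
    then have "v \<in> nehari_set \<Phi>'" by (simp add: nehari_set_def)
    then show "\<Phi> x \<le> \<Phi> v" using x(2) out neg by (cases "v \<in> Y") force+
  qed
  ultimately show ?thesis using neg by auto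
qed

end
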